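(* The pseudoachromatic index of $\mathrm{PG}(3,2)$ equals $18$: $\psi'(\mathrm{PG}(3,2))=18$.
   Context: $\mathrm{PG}(3,2)$ is the $3$-dimensional projective space over $\mathrm{GF}(2)$ (15 points, 35 lines). A coloring with $k$ colors is a surjective map from the set of lines to $\{1,\dots,k\}$. It is complete if for every pair of distinct colors there is a point lying on a line of each of the two colors. The pseudoachromatic index $\psi'$ is the largest $k$ for which a complete (not necessarily proper) coloring with $k$ colors exists. *)

theory Defs
  imports "HOL-Analysis.Cartesian_Space" "HOL-Library.Z2"
begin

definition pg_points :: "('a::field ^ 'n) set set" where
  "pg_points = {P. vec.subspace P \<and> vec.dim P = 1}"

definition pg_lines :: "('a::field ^ 'n) set set" where
  "pg_lines = {L. vec.subspace L \<and> vec.dim L = 2}"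

text \<open>A geometry is given by its set of points, its set of lines and an incidence relation
  (point first). Colours are the naturals from 1 to k.\<close>

definition line_coloring :: "'l set \<Rightarrow> nat \<Rightarrow> ('l \<Rightarrow> nat) \<Rightarrow> bool" where
  "line_coloring Ls k c \<longleftrightarrow> c ` Ls = {1..k}"

definition complete_coloring ::
  "'p set \<Rightarrow> 'l set \<Rightarrow> ('p \<Rightarrow> 'l \<Rightarrow> bool) \<Rightarrow> nat \<Rightarrow> ('l \<Rightarrow> nat) \<Rightarrow> bool" where
  "complete_coloring Ps Ls I k c \<longleftrightarrow> line_coloring Ls k c \<and>
     (\<forall>i\<in>{1..k}. \<forall>j\<in>{1..k}. i \<noteq> j \<longrightarrow>
        (\<exists>p\<in>Ps. \<exists>l\<in>Ls. \<exists>m\<in>Ls. I p l \<and> I p m \<and> c l = i \<and> c m = j))"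

text \<open>If the set of lines is finite, the number of lines bounds every admissible k, so
  \<open>Max\<close> is taken over a finite nonempty set.\<close>

definition pseudoachromatic_index ::
  "'p set \<Rightarrow> 'l set \<Rightarrow> ('p \<Rightarrow> 'l \<Rightarrow> bool) \<Rightarrow> nat" where
  "pseudoachromatic_index Ps Ls I = Max {k. \<exists>c. complete_coloring Ps Ls I k c}"

end

theory Submission imports Defs begin

text \<open>
  Call a line alone if no other line has its colour. As there are only \<open>35 = 2 * 19 - 3\<close> lines, a
  colouring with at least 19 colours has at least three lines that are alone. If it is complete, these
  lines meet pairwise; moreover, every line meets just 18 others, so that the lines met by a line that
  is alone have pairwise distinct colours.

  In Pluecker coordinates, the lines are the nonzero pairs \<open>(d, m)\<close> of vectors in \<open>bit ^ 3\<close> with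
  \<open>d \<cdot> m = 0\<close>, and two lines meet iff the pairs are conjugate. Exchanging \<open>d\<close> and \<open>m\<close> is a duality, which turns a triangle into three
  lines through a point. Hence the three lines form a pencil, or they can be assumed to have a common
  point \<open>p\<close> without being coplanar.

  In a pencil, every line meets one of the three lines, so a line that meets all three is alone as
  well; but there are two skew lines of this kind.

  In the other case, the three lines are the vertices of a triangle in the Fano plane formed by the
  lines through \<open>p\<close>. Every plane through \<open>p\<close> contains four lines off \<open>p\<close>. By the distinctness of colours,
  each colour on the plane over the side \<open>i\<close> of the triangle occurs exactly once on the plane over the
  median \<open>i\<close>, and otherwise only on the four midlines, those over the line of the midpoints. Such a pair
  of lines is given by four bits, and two pairs for different \<open>i\<close> meet unless their bits are
  complementary. The colour of each midpoint needs a midline, so at most one pair shares its colour with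
  a midline, too. Without such a pair for \<open>i\<close>, counting midlines shows that the bits of all pairs for \<open>i\<close>
  have odd sum. This applies to two values of \<open>i\<close>, whose pairs then exhaust the eight odd vectors. But
  there is also an odd pair for the third value, and its complement is already taken.
\<close>

section \<open>Vectors over GF(2)\<close>

declare add_bit_eq_xor [simp del] mult_bit_eq_and [simp del]
  \<comment> \<open>they would rewrite ring operations on bits to bit operations before ring normalisation applies\<close>

lemma UNIV_bit: "(UNIV :: bit set) = {0, 1}"
  using bit.exhaust by blast

lemma ex_bit: "(\<exists>a :: bit. P a) \<longleftrightarrow> P 0 \<or> P 1"
  by (metis bit.exhaust)

instance bit :: finite
  by standard (simp add: UNIV_bit)

lemma card_UNIV_bit [simp]: "CARD(bit) = 2"
  by (simp add: UNIV_bit)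

lemma bit_add_eq_0_iff [simp]: "a + b = 0 \<longleftrightarrow> a = (b :: bit)"
  by (cases a; cases b) simp_all

lemma bit_neq_iff: "a \<noteq> b \<longleftrightarrow> a + 1 = (b :: bit)"
  by (cases a; cases b) simp_all

lemma bit_vec_add_self [simp]: "x + x = (0 :: bit ^ 'n)"
  by (simp add: vec_eq_iff)

lemma bit_vec_add_self_left [simp]: "x + (x + y) = (y :: bit ^ 'n)"
  by (simp flip: add.assoc)

lemma bit_vec_add_eq_0_iff [simp]: "x + y = 0 \<longleftrightarrow> x = (y :: bit ^ 'n)"
  by (metis add.right_neutral bit_vec_add_self_left)

lemma bit_vec_diff [simp]: "x - y = x + (y :: bit ^ 'n)"
  by (simp add: vec_eq_iff)

lemma bit_vec_add_eq_iff: "x + y = z \<longleftrightarrow> x = z + (y :: bit ^ 'n)"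
  by (metis add.commute bit_vec_add_self_left)

definition dot :: "'a::comm_semiring_1 ^ 'n \<Rightarrow> 'a ^ 'n \<Rightarrow> 'a"  (infix "\<cdot>" 70) where
  "x \<cdot> y = (\<Sum>i\<in>UNIV. x $ i * y $ i)"

lemma dot_commute: "x \<cdot> y = y \<cdot> x"
  by (simp add: dot_def mult.commute)

lemma dot_add_left: "(x + y) \<cdot> z = x \<cdot> z + y \<cdot> z"
  by (simp add: dot_def distrib_right sum.distrib)

lemma dot_add_right: "x \<cdot> (y + z) = x \<cdot> y + x \<cdot> z"
  by (simp add: dot_def distrib_left sum.distrib)

lemma dot_smult_left: "(c *s x) \<cdot> y = c * (x \<cdot> y)"
  by (simp add: dot_def sum_distrib_left mult.assoc)

lemma dot_zero [simp]: "0 \<cdot> x = 0" "x \<cdot> 0 = 0"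
  by (simp_all add: dot_def)

lemma dot_axis [simp]: "axis i 1 \<cdot> x = x $ i" "x \<cdot> axis i 1 = x $ i"
  by (simp_all add: dot_def axis_def if_distrib if_distribR cong: if_cong)

lemma card_orthogonal:
  fixes x :: "bit ^ 'n"
  assumes "x \<noteq> 0"
  shows "2 * card {y. y \<cdot> x = 0} = 2 ^ CARD('n)"
proof -
  obtain i where i: "x $ i = 1" using assms by (auto simp: vec_eq_iff)
  have "bij_betw (\<lambda>y. y + axis i 1) {y. y \<cdot> x = 0} {y. y \<cdot> x = 1}"
    by (rule bij_betw_byWitness[where f' = "\<lambda>y. y + axis i 1"])
      (auto simp: dot_add_left i add.assoc)
  then have "card {y. y \<cdot> x = 0} = card {y. y \<cdot> x = 1}"
    by (rule bij_betw_same_card)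
  moreover have "card ({y. y \<cdot> x = 0} \<union> {y. y \<cdot> x = 1}) = card {y. y \<cdot> x = 0} + card {y. y \<cdot> x = 1}"
    by (rule card_Un_disjoint) auto
  moreover have "{y. y \<cdot> x = 0} \<union> {y. y \<cdot> x = 1} = UNIV"
    by auto
  ultimately show ?thesis by simp
qed

lemma dot_one: "distinct [i, j, k] \<Longrightarrow> 1 \<cdot> (v :: 'a::comm_semiring_1 ^ 3) = v $ i + v $ j + v $ k"
  using exhaust_3[of i] exhaust_3[of j] exhaust_3[of k] by (auto simp: dot_def sum_3 ac_simps)

lemma dot_one_one: "1 \<cdot> (1 :: bit ^ 3) = 1"
  by (simp add: dot_def sum_3)

lemma card_orthogonal_vec3: "card {y. y \<cdot> x = 0} = (if x = 0 then 8 else 4)" for x :: "bit ^ 3"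
  using card_orthogonal[of x] by simp

definition cross :: "'a::comm_ring_1 ^ 3 \<Rightarrow> 'a ^ 3 \<Rightarrow> 'a ^ 3"  (infixr "\<otimes>" 75) where
  "x \<otimes> y = vector
     [x $ 2 * y $ 3 - x $ 3 * y $ 2, x $ 3 * y $ 1 - x $ 1 * y $ 3, x $ 1 * y $ 2 - x $ 2 * y $ 1]"

lemma dot_cross_self: "x \<cdot> (x \<otimes> y) = 0" "y \<cdot> (x \<otimes> y) = 0"
  by (simp_all add: dot_def cross_def sum_3 algebra_simps)

lemma cross_zero [simp]: "0 \<otimes> x = 0" "x \<otimes> 0 = 0"
  by (simp_all add: cross_def vec_eq_iff forall_3)

lemma cross_self [simp]: "x \<otimes> x = 0"
  by (simp add: cross_def vec_eq_iff forall_3)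

lemma cross_add_left: "(x + y) \<otimes> z = x \<otimes> z + y \<otimes> z"
  by (simp add: cross_def vec_eq_iff forall_3 algebra_simps)

lemma cross_cross: "(x \<otimes> y) \<otimes> z = (x \<cdot> z) *s y - (y \<cdot> z) *s x"
  by (simp add: cross_def dot_def sum_3 vec_eq_iff forall_3 algebra_simps)

lemma cross_add_right: "x \<otimes> (y + z) = x \<otimes> y + x \<otimes> z"
  by (simp add: cross_def vec_eq_iff forall_3 algebra_simps)

lemma cross_smult_right: "x \<otimes> (c *s y) = c *s (x \<otimes> y)"
  by (simp add: cross_def vec_eq_iff forall_3 algebra_simps)

lemma bit_cross_commute: "x \<otimes> y = y \<otimes> (x :: bit ^ 3)"
  by (simp add: cross_def vec_eq_iff forall_3 algebra_simps)

lemma bit_dot_cross_commute: "x \<cdot> (y \<otimes> z) = z \<cdot> (y \<otimes> (x :: bit ^ 3))"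
  by (simp add: cross_def dot_def sum_3 algebra_simps)

lemma bit_cross_eq_0_iff: "x \<otimes> y = 0 \<longleftrightarrow> x = 0 \<or> y = 0 \<or> x = (y :: bit ^ 3)"
  by (cases "x $ 1"; cases "x $ 2"; cases "x $ 3"; cases "y $ 1"; cases "y $ 2"; cases "y $ 3")
    (simp_all add: cross_def vec_eq_iff forall_3)

lemma bit_cross_of_orthogonal:
  fixes m :: "bit ^ 3"
  assumes "m \<noteq> 0" "x \<cdot> m = 0" "y \<cdot> m = 0"
  shows "\<exists>t. x \<otimes> y = t *s m"
proof -
  have "(x \<otimes> y) \<otimes> m = 0" by (simp add: cross_cross assms)
  then have "x \<otimes> y = 0 \<or> x \<otimes> y = m"
    using assms(1) by (auto simp: bit_cross_eq_0_iff)
  then show ?thesis by (metis vector_smult_lid vector_smult_lzero)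
qed

section \<open>Lines of projective spaces over GF(2)\<close>

lemma bit_span_insert: "y \<in> vec.span (insert x S) \<longleftrightarrow> y \<in> vec.span S \<or> y + x \<in> vec.span (S :: (bit ^ 'n) set)"
  by (simp add: vec.span_breakdown_eq ex_bit)

lemma span_pair: "vec.span {x, y} = {0, x, y, x + (y :: bit ^ 'n)}"
proof -
  have "v \<in> vec.span {x, y} \<longleftrightarrow> v = 0 \<or> v = y \<or> v = x \<or> v = y + x" for v
    by (simp add: bit_span_insert bit_vec_add_eq_iff[of v x])
  then show ?thesis by (auto simp: add.commute)
qed

lemma span_single: "vec.span {x} = {0, x :: bit ^ 'n}"
  using span_pair[of x x] by auto

lemma span_eq_UNIV_if_chain:
  fixes a b c d :: "'a::field ^ 4"
  assumes "a \<noteq> 0" "b \<notin> vec.span {a}" "c \<notin> vec.span {b, a}" "d \<notin> vec.span {c, b, a}"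
  shows "vec.span {d, c, b, a} = UNIV"
proof -
  have indep: "vec.independent {d, c, b, a}"
    using assms by (simp add: vec.independent_insert vec.span_base)
  have "card {d, c, b, a} = 4"
    using assms vec.span_base[of b "{b, a}"] vec.span_base[of c "{c, b, a}"]
    by (auto simp: vec.span_base card_insert_if)
  then show ?thesis
    using vec.card_ge_dim_independent[OF subset_UNIV indep]
    by (simp add: top.extremum_unique vec_dim_card del: vec.dim_UNIV)
qed

lemma ex_not_in_span_3: "\<exists>d :: 'a::field ^ 4. d \<notin> vec.span {c, b, a}"
proof -
  have "vec.dim {c, b, a} \<le> card {c, b, a}" by (rule vec.dim_le_card') simp
  also have "\<dots> \<le> 3" by (simp add: card_insert_if)
  finally have "vec.dim (vec.span {c, b, a}) \<noteq> vec.dim (UNIV :: ('a ^ 4) set)"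
    by (simp add: vec_dim_card del: vec.dim_UNIV)
  then show ?thesis by (metis UNIV_eq_I)
qed

lemma pg_lines_iff:
  "L \<in> pg_lines \<longleftrightarrow> (\<exists>x y :: bit ^ 'n. x \<noteq> 0 \<and> y \<noteq> 0 \<and> x \<noteq> y \<and> L = {0, x, y, x + y})"
proof
  assume "L \<in> pg_lines"
  then have L: "vec.subspace L" "vec.dim L = 2" by (auto simp: pg_lines_def)
  obtain B where B: "B \<subseteq> L" "vec.independent B" "L \<subseteq> vec.span B" "card B = vec.dim L"
    using vec.basis_exists by metis
  then obtain x y where xy: "B = {x, y}" "x \<noteq> y" using L(2) by (metis card_2_iff)
  moreover have "L = vec.span B" using B L(1) by (metis vec.span_minimal subset_antisym)
  moreover have "x \<noteq> 0" "y \<noteq> 0" using B(2) vec.dependent_zero xy by auto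
  ultimately show "\<exists>x y. x \<noteq> 0 \<and> y \<noteq> 0 \<and> x \<noteq> y \<and> L = {0, x, y, x + y}"
    by (auto simp: span_pair)
next
  assume "\<exists>x y. x \<noteq> 0 \<and> y \<noteq> 0 \<and> x \<noteq> y \<and> L = {0, x, y, x + y}"
  then obtain x y where xy: "x \<noteq> 0" "y \<noteq> 0" "x \<noteq> y" "L = vec.span {x, y}"
    by (auto simp: span_pair)
  have "vec.independent {x, y}"
    using xy by (auto simp: vec.independent_insert span_single)
  then have "vec.dim L = 2" using xy by (metis card_2_iff vec.dim_span_eq_card_independent)
  then show "L \<in> pg_lines" using xy(4) by (simp add: pg_lines_def)
qed

lemma pg_lines_add_closed:
  "L \<in> pg_lines \<Longrightarrow> x \<in> L \<Longrightarrow> y \<in> L \<Longrightarrow> x + y \<in> L"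
  by (simp add: pg_lines_def vec.subspace_add)

lemma pg_line_span_subset: "L \<in> pg_lines \<Longrightarrow> S \<subseteq> L \<Longrightarrow> vec.span S \<subseteq> L"
  by (simp add: pg_lines_def vec.span_minimal)

lemma pg_line_other_point:
  fixes x :: "bit ^ 'n"
  assumes "L \<in> pg_lines"
  obtains y where "y \<in> L" "y \<noteq> 0" "y \<noteq> x"
  using assms by (auto simp: pg_lines_iff)

lemma card_pg_line:
  fixes L :: "(bit ^ 'n) set"
  assumes "L \<in> pg_lines"
  shows "card L = 4"
proof -
  obtain x y where "x \<noteq> 0" "y \<noteq> 0" "x \<noteq> y" "L = {0, x, y, x + y}"
    using assms by (auto simp: pg_lines_iff)
  then show ?thesis by (simp add: eq_commute[of 0] eq_commute[of x "x + y"] eq_commute[of y "x + y"])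
qed

lemma closed_card_4_is_pg_line:
  fixes L :: "(bit ^ 'n) set"
  assumes closed: "\<And>x y. x \<in> L \<Longrightarrow> y \<in> L \<Longrightarrow> x + y \<in> L" and card: "card L = 4"
  shows "L \<in> pg_lines"
proof -
  have ex: "\<exists>x\<in>L. x \<notin> A" if "finite A" "card A < 4" for A
    using card_mono[OF that(1), of L] that(2) card by fastforce
  obtain x where x: "x \<in> L" "x \<notin> {0}" using ex[of "{0}"] by auto
  have "card {0, x} \<le> 2" by (simp add: card_insert_if)
  then obtain y where y: "y \<in> L" "y \<notin> {0, x}" using ex[of "{0, x}"] by auto
  have line: "{0, x, y, x + y} \<in> pg_lines" using x y by (auto simp: pg_lines_iff)
  have "{0, x, y, x + y} \<subseteq> L" using x y closed[of x x] closed[of x y] by auto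
  then have "{0, x, y, x + y} = L"
    by (intro card_subset_eq) (use card card_pg_line[OF line] card.infinite[of L] in auto)
  then show ?thesis using line by simp
qed

lemma pg_line_through_two:
  fixes L :: "(bit ^ 'n) set"
  assumes "L \<in> pg_lines" "x \<in> L" "y \<in> L" "x \<noteq> 0" "y \<noteq> 0" "x \<noteq> y"
  shows "L = {0, x, y, x + y}"
proof -
  have "{0, x, y, x + y} \<in> pg_lines" using assms(4-6) by (auto simp: pg_lines_iff)
  then have "card {0, x, y, x + y} = card L" using assms(1) by (metis card_pg_line)
  moreover have "{0, x, y, x + y} \<subseteq> L"
    using assms pg_lines_add_closed[of L x x] pg_lines_add_closed[of L x y] by auto
  moreover have "finite L" using card_pg_line[OF assms(1)] card.infinite by fastforce
  ultimately show ?thesis by (metis card_subset_eq)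
qed

lemma pg_line_eqI:
  fixes L M :: "(bit ^ 'n) set"
  assumes "L \<in> pg_lines" "M \<in> pg_lines" "x \<in> L" "y \<in> L" "x \<in> M" "y \<in> M" "x \<noteq> 0" "y \<noteq> 0" "x \<noteq> y"
  shows "L = M"
  using pg_line_through_two[of L x y] pg_line_through_two[of M x y] assms by simp

definition concurrent :: "'a::zero set \<Rightarrow> 'a set \<Rightarrow> bool" where
  "concurrent L M \<longleftrightarrow> (\<exists>x. x \<noteq> 0 \<and> x \<in> L \<and> x \<in> M)"

lemma concurrent_iff_common_pg_point:
  assumes "L \<in> pg_lines" "M \<in> pg_lines"
  shows "concurrent L M \<longleftrightarrow> (\<exists>p\<in>pg_points. p \<subseteq> L \<and> p \<subseteq> M)"
proof
  assume "\<exists>p\<in>pg_points. p \<subseteq> L \<and> p \<subseteq> M"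
  then obtain p where p: "vec.dim p = 1" "p \<subseteq> L" "p \<subseteq> M" by (auto simp: pg_points_def)
  have "\<not> p \<subseteq> {0}" using p(1) vec.dim_eq_0 by (metis zero_neq_one)
  then show "concurrent L M" using p by (auto simp: concurrent_def)
next
  assume "concurrent L M"
  then obtain x where x: "x \<noteq> 0" "x \<in> L" "x \<in> M" by (auto simp: concurrent_def)
  have "vec.span {x} \<subseteq> L" "vec.span {x} \<subseteq> M"
    using assms x by (simp_all add: pg_line_span_subset)
  moreover have "vec.span {x} \<in> pg_points"
    using x(1) by (simp add: pg_points_def vec.dim_span_eq_card_independent)
  ultimately show "\<exists>p\<in>pg_points. p \<subseteq> L \<and> p \<subseteq> M" by blast
qed

section \<open>Pluecker coordinates and the Klein quadric\<close>

text \<open>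
  The points \<open>(t, x)\<close> and \<open>(s, y)\<close> span the line with direction \<open>d = t *s y + s *s x\<close> and moment \<open>m = x \<otimes> y\<close>;
  signs do not matter in characteristic 2.
\<close>

type_synonym plucker = "(bit ^ 3) \<times> (bit ^ 3)"

definition klein_quadric :: "plucker set" where
  "klein_quadric = {(d, m). d \<cdot> m = 0} - {0}"

definition conjugate :: "plucker \<Rightarrow> plucker \<Rightarrow> bool" where
  "conjugate u v \<longleftrightarrow> fst u \<cdot> snd v = fst v \<cdot> snd u"

definition plucker_line :: "plucker \<Rightarrow> (bit \<times> (bit ^ 3)) set" where
  "plucker_line u = {(t, x). x \<cdot> snd u = 0 \<and> x \<otimes> fst u = t *s snd u}"

lemma in_klein_quadric [simp]: "(d, m) \<in> klein_quadric \<longleftrightarrow> d \<cdot> m = 0 \<and> (d \<noteq> 0 \<or> m \<noteq> 0)"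
  by (auto simp: klein_quadric_def zero_prod_def)

lemma conjugate_Pair [simp]: "conjugate (d, m) (d', m') \<longleftrightarrow> d \<cdot> m' = d' \<cdot> m"
  by (simp add: conjugate_def)

lemma in_plucker_line [simp]: "(t, x) \<in> plucker_line (d, m) \<longleftrightarrow> x \<cdot> m = 0 \<and> x \<otimes> d = t *s m"
  by (simp add: plucker_line_def)

lemma conjugate_commute: "conjugate u v \<longleftrightarrow> conjugate v u"
  by (auto simp: conjugate_def)

lemma eq_if_conjugate_iff:
  assumes "\<And>w. w \<in> klein_quadric \<Longrightarrow> conjugate u w \<longleftrightarrow> conjugate v w"
  shows "u = v"
proof -
  have "axis i 1 \<noteq> (0 :: bit ^ 3)" for i by (simp add: axis_eq_0_iff)
  then have "fst u $ i = fst v $ i \<and> snd u $ i = snd v $ i" for i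
    using assms[of "(axis i 1, 0)"] assms[of "(0, axis i 1)"]
    by (cases "fst u $ i"; cases "fst v $ i"; cases "snd u $ i"; cases "snd v $ i")
      (simp_all add: conjugate_def)
  then show ?thesis by (simp add: prod_eq_iff vec_eq_iff)
qed

lemma card_klein_quadric: "card klein_quadric = 35"
proof -
  have "{(d, m). d \<cdot> m = (0 :: bit)} = (SIGMA d : UNIV :: (bit ^ 3) set. {m. m \<cdot> d = 0})"
    by (auto simp: dot_commute)
  then have "card {(d :: bit ^ 3, m). d \<cdot> m = (0 :: bit)} = (\<Sum>d\<in>UNIV. if d = (0 :: bit ^ 3) then 8 else 4)"
    by (simp add: card_SigmaI card_orthogonal_vec3)
  also have "\<dots> = 8 + (\<Sum>d\<in>UNIV - {0 :: bit ^ 3}. 4)"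
    by (subst sum.remove[of _ 0]) simp_all
  also have "\<dots> = 36" by simp
  finally show ?thesis by (simp add: klein_quadric_def zero_prod_def)
qed

lemma plucker_line_add_closed:
  "a \<in> plucker_line u \<Longrightarrow> b \<in> plucker_line u \<Longrightarrow> a + b \<in> plucker_line u"
  by (cases a; cases b; cases u) (simp add: dot_add_left cross_add_left vector_sadd_rdistrib)

lemma card_plucker_line:
  assumes "u \<in> klein_quadric"
  shows "card (plucker_line u) = 4"
proof -
  obtain d m where u: "u = (d, m)" and dm: "d \<cdot> m = 0" "d \<noteq> 0 \<or> m \<noteq> 0" using assms by (cases u) auto
  show ?thesis
  proof (cases "m = 0")
    case True
    then have "plucker_line u = UNIV \<times> {0, d}" using u dm by (auto simp: bit_cross_eq_0_iff)
    then show ?thesis using True dm by (simp add: card_cartesian_product)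
  next
    case False
    have "bij_betw snd (plucker_line u) {x. x \<cdot> m = 0}"
    proof (rule bij_betw_imageI)
      show "inj_on snd (plucker_line u)"
        using False by (auto simp: u inj_on_def)
      have "x \<in> snd ` plucker_line u" if x: "x \<cdot> m = 0" for x
      proof -
        obtain t where "x \<otimes> d = t *s m" using bit_cross_of_orthogonal[OF False x dm(1)] by blast
        then show ?thesis by (intro image_eqI[of _ _ "(t, x)"]) (simp_all add: u x)
      qed
      then show "snd ` plucker_line u = {x. x \<cdot> m = 0}" by (auto simp: u)
    qed
    then show ?thesis using False by (simp add: bij_betw_same_card card_orthogonal_vec3)
  qed
qed

lemma conjugate_if_concurrent:
  assumes "concurrent (plucker_line u) (plucker_line v)"
  shows "conjugate u v"
proof -
  obtain d m d' m' where u: "u = (d, m)" and v: "v = (d', m')" by (cases u; cases v) blast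
  obtain t x where "(t, x) \<noteq> 0" and x: "x \<cdot> m = 0" "x \<otimes> d = t *s m" "x \<cdot> m' = 0" "x \<otimes> d' = t *s m'"
    using assms by (auto simp: concurrent_def u v)
  show ?thesis
  proof (cases "t = 0")
    case False
    then have "m = x \<otimes> d" "m' = x \<otimes> d'" using x by simp_all
    then show ?thesis by (simp add: u v bit_dot_cross_commute[of d])
  next
    case True
    then have "x \<noteq> 0" using \<open>(t, x) \<noteq> 0\<close> by (simp add: zero_prod_def)
    then have "d \<in> {0, x}" "d' \<in> {0, x}" using True x by (auto simp: bit_cross_eq_0_iff)
    then show ?thesis using x(1,3) by (auto simp: u v)
  qed
qed

lemma concurrent_commute: "concurrent L M \<longleftrightarrow> concurrent M L"
  by (auto simp: concurrent_def)

lemma concurrent_star_line: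
  assumes "(d, 0) \<in> klein_quadric" "(d', m) \<in> klein_quadric" "d \<cdot> m = 0"
  shows "concurrent (plucker_line (d, 0)) (plucker_line (d', m))"
proof (cases "m = 0")
  case True
  then have "(1, 0) \<in> plucker_line (d, 0)" "(1, 0) \<in> plucker_line (d', m)" by simp_all
  then show ?thesis unfolding concurrent_def by (intro exI[of _ "(1, 0)"]) (simp add: zero_prod_def)
next
  case False
  obtain t where "d \<otimes> d' = t *s m" using bit_cross_of_orthogonal[of m d d'] False assms by auto
  then have "(t, d) \<in> plucker_line (d, 0)" "(t, d) \<in> plucker_line (d', m)" using assms by simp_all
  then show ?thesis
    using assms(1) unfolding concurrent_def by (intro exI[of _ "(t, d)"]) (simp add: zero_prod_def)
qed

lemma concurrent_if_conjugate:
  assumes uv: "u \<in> klein_quadric" "v \<in> klein_quadric" and "conjugate u v"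
  shows "concurrent (plucker_line u) (plucker_line v)"
proof -
  obtain d m d' m' where u: "u = (d, m)" and v: "v = (d', m')" by (cases u; cases v) blast
  have perp: "d \<cdot> m = 0" "d' \<cdot> m' = 0" and conj: "m' \<cdot> d = m \<cdot> d'"
    using assms by (simp_all add: u v dot_commute)
  consider (equal) "u = v" | (left_star) "m = 0" | (right_star) "m' = 0"
    | (coplanar) "m = m'" "m \<noteq> 0" "d \<noteq> d'" | (generic) "m \<noteq> 0" "m' \<noteq> 0" "m \<noteq> m'"
    using u v by blast
  then show ?thesis
  proof cases
    case equal
    have "\<not> plucker_line u \<subseteq> {0}"
      using card_mono[of "{0}" "plucker_line u"] card_plucker_line[OF uv(1)] by auto
    then show ?thesis using equal by (auto simp: concurrent_def)
  next
    case left_star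
    then show ?thesis using concurrent_star_line[of d d' m'] uv conj by (simp add: u v dot_commute)
  next
    case right_star
    then show ?thesis
      using concurrent_star_line[of d' d m] uv conj concurrent_commute[of "plucker_line u"]
      by (simp add: u v dot_commute)
  next
    case coplanar
    obtain t where "d' \<otimes> d = t *s m" using bit_cross_of_orthogonal[of m d' d] coplanar perp by auto
    then show ?thesis using coplanar perp unfolding concurrent_def
      by (intro exI[of _ "(t, d + d')"])
        (simp add: u v dot_add_left cross_add_left bit_cross_commute[of d d'] zero_prod_def)
  next
    case generic
    then show ?thesis using perp conj unfolding concurrent_def
      by (intro exI[of _ "(m' \<cdot> d, m \<otimes> m')"])
        (simp add: u v zero_prod_def bit_cross_eq_0_iff dot_cross_self cross_cross dot_commute)
  qed
qed

lemma ex_plucker_line_through: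
  assumes "a \<noteq> 0" "b \<noteq> 0" "a \<noteq> b"
  shows "\<exists>u\<in>klein_quadric. a \<in> plucker_line u \<and> b \<in> plucker_line u"
proof -
  obtain t x s y where ab: "a = (t, x)" "b = (s, y)" by (cases a; cases b)
  have "(t *s y + s *s x, x \<otimes> y) \<in> klein_quadric"
    using assms by (cases t; cases s)
      (auto simp: ab zero_prod_def dot_add_left dot_smult_left dot_cross_self bit_cross_eq_0_iff)
  moreover have "a \<in> plucker_line (t *s y + s *s x, x \<otimes> y)" "b \<in> plucker_line (t *s y + s *s x, x \<otimes> y)"
    by (simp_all add: ab dot_cross_self cross_add_right cross_smult_right bit_cross_commute[of y])
  ultimately show ?thesis by blast
qed

section \<open>Labelling the lines of PG(3,2)\<close>

definition klein_labelling :: "(plucker \<Rightarrow> (bit ^ 4) set) \<Rightarrow> bool" where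
  "klein_labelling l \<longleftrightarrow> bij_betw l klein_quadric pg_lines \<and>
     (\<forall>u\<in>klein_quadric. \<forall>v\<in>klein_quadric. concurrent (l u) (l v) \<longleftrightarrow> conjugate u v)"

lemma klein_labellingD:
  assumes "klein_labelling l"
  shows "bij_betw l klein_quadric pg_lines"
    and "u \<in> klein_quadric \<Longrightarrow> v \<in> klein_quadric \<Longrightarrow> concurrent (l u) (l v) \<longleftrightarrow> conjugate u v"
  using assms by (simp_all add: klein_labelling_def)

locale frame =
  fixes e :: "bit \<times> (bit ^ 3) \<Rightarrow> bit ^ 4"
  assumes bij: "bij e" and add: "e (a + b) = e a + e b"
begin

definition line :: "plucker \<Rightarrow> (bit ^ 4) set" where
  "line u = e ` plucker_line u"

lemma inj_iff: "e a = e b \<longleftrightarrow> a = b"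
  using bij by (simp add: bij_def inj_eq)

lemma zero: "e 0 = 0"
  using add[of 0 0] by simp

lemma eq_0_iff: "e a = 0 \<longleftrightarrow> a = 0"
  using inj_iff[of a 0] by (simp add: zero)

lemma in_line_iff: "e a \<in> line u \<longleftrightarrow> a \<in> plucker_line u"
  by (auto simp: line_def inj_iff)

lemma concurrent_image_iff: "concurrent (e ` A) (e ` B) \<longleftrightarrow> concurrent A B"
  by (auto simp: concurrent_def inj_iff image_iff) (metis inj_iff zero)+

lemma line_in_pg_lines:
  assumes "u \<in> klein_quadric"
  shows "line u \<in> pg_lines"
proof (rule closed_card_4_is_pg_line)
  have "card (line u) = card (plucker_line u)"
    unfolding line_def by (rule card_image) (simp add: inj_on_def inj_iff)
  then show "card (line u) = 4" using card_plucker_line[OF assms] by simp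
next
  fix x y assume "x \<in> line u" "y \<in> line u"
  then obtain a b where "x = e a" "y = e b" "a \<in> plucker_line u" "b \<in> plucker_line u" by (auto simp: line_def)
  then show "x + y \<in> line u"
    unfolding line_def using plucker_line_add_closed[of a u b] by (metis add imageI)
qed

lemma line_eqI:
  assumes "u \<in> klein_quadric" "L \<in> pg_lines" "a \<in> plucker_line u" "b \<in> plucker_line u"
    and "e a \<in> L" "e b \<in> L" "a \<noteq> 0" "b \<noteq> 0" "a \<noteq> b"
  shows "line u = L"
  by (rule pg_line_eqI[of _ _ "e a" "e b"])
    (use assms in \<open>simp_all add: line_in_pg_lines in_line_iff eq_0_iff inj_iff\<close>)

lemma concurrent_line_iff:
  assumes "u \<in> klein_quadric" "v \<in> klein_quadric"
  shows "concurrent (line u) (line v) \<longleftrightarrow> conjugate u v"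
  unfolding line_def concurrent_image_iff using assms conjugate_if_concurrent concurrent_if_conjugate by blast

lemma ex_line_eq:
  assumes "L \<in> pg_lines"
  shows "\<exists>u\<in>klein_quadric. line u = L"
proof -
  obtain x y where xy: "x \<noteq> 0" "y \<noteq> 0" "x \<noteq> y" "x \<in> L" "y \<in> L"
    using assms by (auto simp: pg_lines_iff)
  obtain a b where ab: "x = e a" "y = e b" using bij by (metis bij_pointE)
  then have nz: "a \<noteq> 0" "b \<noteq> 0" "a \<noteq> b" using xy zero by auto
  then obtain u where "u \<in> klein_quadric" "a \<in> plucker_line u" "b \<in> plucker_line u"
    using ex_plucker_line_through by blast
  then show ?thesis using line_eqI[of u L a b] assms xy ab nz by blast
qed

lemma klein_labelling_line: "klein_labelling line"
proof -
  have "inj_on line klein_quadric"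
  proof (rule inj_onI, rule eq_if_conjugate_iff)
    fix u v w assume "u \<in> klein_quadric" "v \<in> klein_quadric" "line u = line v"
      and "w \<in> klein_quadric"
    then show "conjugate u w \<longleftrightarrow> conjugate v w"
      using concurrent_line_iff[of u w] concurrent_line_iff[of v w] by simp
  qed
  moreover have "line ` klein_quadric = pg_lines"
    using ex_line_eq by (auto simp: line_in_pg_lines)
  ultimately show ?thesis
    by (simp add: klein_labelling_def bij_betw_def concurrent_line_iff)
qed

end

lemma conjugate_swap [simp]: "conjugate (prod.swap u) (prod.swap v) \<longleftrightarrow> conjugate u v"
  by (cases u; cases v) (auto simp: dot_commute)

lemma klein_labelling_dual:
  assumes "klein_labelling l"
  shows "klein_labelling (l \<circ> prod.swap)"
proof -
  have "bij_betw prod.swap klein_quadric klein_quadric"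
    by (rule bij_betw_byWitness[where f' = prod.swap]) (auto simp: dot_commute)
  then have "bij_betw (l \<circ> prod.swap) klein_quadric pg_lines"
    by (rule bij_betw_trans) (use assms in \<open>simp add: klein_labelling_def\<close>)
  then show ?thesis
    using assms by (simp add: klein_labelling_def bij_betwE[OF \<open>bij_betw prod.swap _ _\<close>])
qed

definition frame_map :: "bit ^ 4 \<Rightarrow> bit ^ 4 \<Rightarrow> bit ^ 4 \<Rightarrow> bit ^ 4 \<Rightarrow> bit \<times> (bit ^ 3) \<Rightarrow> bit ^ 4" where
  "frame_map p u1 u2 u3 = (\<lambda>(t, x). t *s p + x $ 1 *s u1 + x $ 2 *s u2 + x $ 3 *s u3)"

lemma frame_map_simps [simp]:
  "frame_map p u1 u2 u3 (1, 0) = p" "frame_map p u1 u2 u3 (0, axis 1 1) = u1"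
  "frame_map p u1 u2 u3 (0, axis 2 1) = u2" "frame_map p u1 u2 u3 (0, axis 3 1) = u3"
  by (simp_all add: frame_map_def axis_def)

lemma frame_frame_map:
  assumes "vec.span {p, u1, u2, u3} = UNIV"
  shows "frame (frame_map p u1 u2 u3)"
proof
  let ?e = "frame_map p u1 u2 u3"
  show add: "?e (a + b) = ?e a + ?e b" for a b
    by (cases a; cases b) (simp add: frame_map_def vector_sadd_rdistrib ac_simps)
  have "{p, u1, u2, u3} \<subseteq> range ?e"
    using rangeI[of ?e "(1, 0)"] rangeI[of ?e "(0, axis 1 1)"] rangeI[of ?e "(0, axis 2 1)"]
      rangeI[of ?e "(0, axis 3 1)"] by simp
  moreover have "vec.subspace (range ?e)"
  proof (rule vec.subspaceI)
    show zero: "0 \<in> range ?e"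
      using rangeI[of ?e 0] by (simp add: frame_map_def zero_prod_def)
    show "x + y \<in> range ?e" if xy: "x \<in> range ?e" "y \<in> range ?e" for x y
    proof -
      obtain a b where "x = ?e a" "y = ?e b" using xy by blast
      then show ?thesis using rangeI[of ?e "a + b"] by (simp only: add)
    qed
    show "c *s x \<in> range ?e" if "x \<in> range ?e" for c x
      using that zero by (cases c) simp_all
  qed
  ultimately have "vec.span {p, u1, u2, u3} \<subseteq> range ?e" by (rule vec.span_minimal)
  then have surj: "surj ?e" using assms by (simp add: top.extremum_unique)
  have "CARD(bit \<times> (bit ^ 3)) = CARD(bit ^ 4)" by simp
  then have "inj ?e" by (intro eq_card_imp_inj_on) (simp_all only: surj finite)
  then show "bij ?e" using surj by (simp only: bij_def)
qed

definition vertex :: "3 \<Rightarrow> plucker" where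
  "vertex i = (axis i 1, 0)"

lemma (in frame) line_vertex_eqI:
  assumes "L \<in> pg_lines" "e (1, 0) \<in> L" "e (0, axis i 1) \<in> L"
  shows "line (vertex i) = L"
  by (rule line_eqI[of _ _ "(1, 0)" "(0, axis i 1)"])
    (use assms in \<open>simp_all add: vertex_def zero_prod_def axis_eq_0_iff\<close>)

lemma (in frame) line_dual_vertex_eqI:
  assumes "L \<in> pg_lines" "e (0, axis j 1) \<in> L" "e (0, axis k 1) \<in> L" "distinct [i, j, k]"
  shows "line (prod.swap (vertex i)) = L"
  by (rule line_eqI[of _ _ "(0, axis j 1)" "(0, axis k 1)"])
    (use assms in \<open>simp_all add: vertex_def zero_prod_def axis_eq_0_iff axis_eq_axis\<close>, simp_all add: axis_def)

lemma ex_labelling_of_star: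
  assumes lines: "A \<in> pg_lines" "B \<in> pg_lines" "C \<in> pg_lines"
    and points: "{p, u} \<subseteq> A" "{p, v} \<subseteq> B" "{p, w} \<subseteq> C"
    and chain: "p \<noteq> 0" "u \<notin> vec.span {p}" "v \<notin> vec.span {u, p}" "w \<notin> vec.span {v, u, p}"
  shows "\<exists>l. klein_labelling l \<and> l (vertex 1) = A \<and> l (vertex 2) = B \<and> l (vertex 3) = C"
proof -
  interpret frame "frame_map p u v w"
    by (intro frame_frame_map) (use span_eq_UNIV_if_chain[OF chain] in \<open>simp add: insert_commute\<close>)
  show ?thesis
    using klein_labelling_line
    by (intro exI[of _ line])
      (use lines points in \<open>simp add: line_vertex_eqI\<close>)
qed

lemma ex_labelling_of_pencil:
  assumes lines: "A \<in> pg_lines" "B \<in> pg_lines" "C \<in> pg_lines"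
    and points: "{p, u} \<subseteq> A" "{p, v} \<subseteq> B" "{p, u + v} \<subseteq> C"
    and chain: "p \<noteq> 0" "u \<notin> vec.span {p}" "v \<notin> vec.span {u, p}"
  shows "\<exists>l. klein_labelling l \<and> l (vertex 1) = A \<and> l (vertex 2) = B \<and> l (vertex 1 + vertex 2) = C"
proof -
  obtain x where x: "x \<notin> vec.span {v, u, p}" using ex_not_in_span_3 by blast
  interpret frame "frame_map p u v x"
    by (intro frame_frame_map) (use span_eq_UNIV_if_chain[OF chain x] in \<open>simp add: insert_commute\<close>)
  have "line (vertex 1 + vertex 2) = C"
    by (rule line_eqI[of _ _ "(1, 0)" "(0, axis 1 1 + axis 2 1)"])
      (use lines points add[of "(0, axis 1 1)" "(0, axis 2 1)"] in
        \<open>simp_all add: vertex_def zero_prod_def axis_eq_axis\<close>)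
  then show ?thesis
    using klein_labelling_line
    by (intro exI[of _ line])
      (use lines points in \<open>simp add: line_vertex_eqI\<close>)
qed

lemma ex_labelling_of_lines_through_point:
  assumes lines: "A \<in> pg_lines" "B \<in> pg_lines" "C \<in> pg_lines" and neq: "A \<noteq> B" "A \<noteq> C" "B \<noteq> C"
    and p: "p \<noteq> 0" "p \<in> A" "p \<in> B" "p \<in> C"
  shows "\<exists>l. klein_labelling l \<and> l (vertex 1) = A \<and> l (vertex 2) = B \<and>
    (l (vertex 3) = C \<or> l (vertex 1 + vertex 2) = C)"
proof -
  obtain u where u: "u \<in> A" "u \<noteq> 0" "u \<noteq> p" using pg_line_other_point[OF lines(1)] .
  obtain v where v: "v \<in> B" "v \<noteq> 0" "v \<noteq> p" using pg_line_other_point[OF lines(2)] .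
  obtain w where w: "w \<in> C" "w \<noteq> 0" "w \<noteq> p" using pg_line_other_point[OF lines(3)] .
  have "v \<notin> A" "w \<notin> A" "w \<notin> B"
    using pg_line_eqI[of A B p v] pg_line_eqI[of A C p w] pg_line_eqI[of B C p w] lines neq p v w by auto
  have "vec.span {u, p} \<subseteq> A" by (rule pg_line_span_subset) (use lines p u in auto)
  then have chain: "u \<notin> vec.span {p}" "v \<notin> vec.span {u, p}"
    using u \<open>v \<notin> A\<close> by (auto simp: span_single)
  show ?thesis
  proof (cases "w \<in> vec.span {v, u, p}")
    case False
    then show ?thesis using ex_labelling_of_star[OF lines _ _ _ p(1) chain] p u v w by auto
  next
    case True
    then have "w + v \<in> vec.span {u, p}"
      using \<open>w \<notin> A\<close> \<open>vec.span {u, p} \<subseteq> A\<close> by (auto simp: bit_span_insert[of w v])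
    moreover have "w + v \<noteq> 0" "w + v \<noteq> p"
      using \<open>w \<notin> B\<close> v pg_lines_add_closed[OF lines(2) p(3) v(1)] by (auto simp: bit_vec_add_eq_iff)
    ultimately have "w + v = u \<or> w + v = u + p"
      by (simp add: span_pair)
    then have "u + v = w \<or> u + v = w + p"
      by (auto simp: bit_vec_add_eq_iff[of w v] add.assoc add.commute[of p])
    then have "u + v \<in> C"
      using w(1) pg_lines_add_closed[OF lines(3) w(1) p(4)] by auto
    then show ?thesis using ex_labelling_of_pencil[OF lines _ _ _ p(1) chain] p u v by auto
  qed
qed

lemma ex_labelling_of_triangle:
  assumes lines: "A \<in> pg_lines" "B \<in> pg_lines" "C \<in> pg_lines"
    and x: "x \<in> B" "x \<in> C" "x \<notin> A" and y: "y \<in> A" "y \<in> C" and z: "z \<in> A" "z \<in> B" "z \<notin> C"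
    and nz: "y \<noteq> 0" "z \<noteq> 0"
  shows "\<exists>l. klein_labelling l \<and> l (vertex 1) = A \<and> l (vertex 2) = B \<and> l (vertex 3) = C"
proof -
  have "vec.span {y, z} \<subseteq> A" by (rule pg_line_span_subset) (use lines y z in auto)
  then have chain: "y \<notin> vec.span {z}" "x \<notin> vec.span {y, z}"
    using x y z nz by (auto simp: span_single)
  obtain p where p: "p \<notin> vec.span {x, y, z}" using ex_not_in_span_3 by blast
  interpret frame "frame_map p x y z"
    by (intro frame_frame_map span_eq_UNIV_if_chain nz chain p)
  show ?thesis
    using klein_labelling_dual[OF klein_labelling_line] lines x y z
      line_dual_vertex_eqI[of A 2 3 1] line_dual_vertex_eqI[of B 1 3 2] line_dual_vertex_eqI[of C 1 2 3]
    by (intro exI[of _ "line \<circ> prod.swap"]) simp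
qed

lemma ex_labelling_of_concurrent_lines:
  assumes lines: "A \<in> pg_lines" "B \<in> pg_lines" "C \<in> pg_lines" and neq: "A \<noteq> B" "A \<noteq> C" "B \<noteq> C"
    and conc: "concurrent A B" "concurrent A C" "concurrent B C"
  shows "\<exists>l. klein_labelling l \<and> l (vertex 1) = A \<and> l (vertex 2) = B \<and>
    (l (vertex 3) = C \<or> l (vertex 1 + vertex 2) = C)"
proof -
  obtain x y z where x: "x \<noteq> 0" "x \<in> B" "x \<in> C" and y: "y \<noteq> 0" "y \<in> A" "y \<in> C"
    and z: "z \<noteq> 0" "z \<in> A" "z \<in> B"
    using conc by (auto simp: concurrent_def)
  show ?thesis
  proof (cases "x \<in> A \<or> z \<in> C")
    case True
    then show ?thesis using ex_labelling_of_lines_through_point[OF lines neq] x z by blast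
  next
    case False
    then show ?thesis using ex_labelling_of_triangle[OF lines x(2,3) _ y(2,3) z(2,3) _ y(1) z(1)] by blast
  qed
qed

lemma ex_klein_labelling: "\<exists>l. klein_labelling l"
proof -
  obtain a b c d :: "bit ^ 4" where "a \<notin> vec.span {0, 0, 0}" "b \<notin> vec.span {a, a, a}"
    "c \<notin> vec.span {b, b, a}" "d \<notin> vec.span {c, b, a}"
    using ex_not_in_span_3 by meson
  then have "vec.span {d, c, b, a} = UNIV"
    by (intro span_eq_UNIV_if_chain) (simp_all add: span_single)
  then interpret frame "frame_map d c b a" by (rule frame_frame_map)
  show ?thesis using klein_labelling_line by blast
qed

lemma card_pg_lines_PG32: "card (pg_lines :: (bit ^ 4) set set) = 35"
proof -
  obtain l where "klein_labelling l" using ex_klein_labelling by blast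
  then show ?thesis
    using bij_betw_same_card[OF klein_labellingD(1)] card_klein_quadric by metis
qed

section \<open>Complete colourings\<close>

definition complete_on :: "'a set \<Rightarrow> ('a \<Rightarrow> 'a \<Rightarrow> bool) \<Rightarrow> ('a \<Rightarrow> 'c) \<Rightarrow> bool" where
  "complete_on X R c \<longleftrightarrow>
     (\<forall>x\<in>X. \<forall>y\<in>X. c x \<noteq> c y \<longrightarrow> (\<exists>x'\<in>X. \<exists>y'\<in>X. c x' = c x \<and> c y' = c y \<and> R x' y'))"

definition alone :: "'a set \<Rightarrow> ('a \<Rightarrow> 'c) \<Rightarrow> 'a \<Rightarrow> bool" where
  "alone X c a \<longleftrightarrow> a \<in> X \<and> (\<forall>x\<in>X. c x = c a \<longrightarrow> x = a)"

lemma aloneI: "a \<in> X \<Longrightarrow> (\<And>x. x \<in> X \<Longrightarrow> c x = c a \<Longrightarrow> x = a) \<Longrightarrow> alone X c a"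
  by (simp add: alone_def)

lemma aloneD:
  assumes "alone X c a"
  shows "a \<in> X" "x \<in> X \<Longrightarrow> c x = c a \<Longrightarrow> x = a"
  using assms by (simp_all add: alone_def)

lemma complete_onE:
  assumes "complete_on X R c" "x \<in> X" "y \<in> X" "c x \<noteq> c y"
  obtains x' y' where "x' \<in> X" "y' \<in> X" "c x' = c x" "c y' = c y" "R x' y'"
  using assms unfolding complete_on_def by blast

lemma complete_on_bij_betw:
  assumes "bij_betw l X Y" "\<And>u v. u \<in> X \<Longrightarrow> v \<in> X \<Longrightarrow> S (l u) (l v) \<longleftrightarrow> R u v"
  shows "complete_on Y S c \<longleftrightarrow> complete_on X R (c \<circ> l)"
proof -
  have "Y = l ` X" using assms(1) by (simp add: bij_betw_def)
  then show ?thesis using assms(2) by (simp add: complete_on_def)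
qed

lemma alone_bij_betw:
  assumes "bij_betw l X Y" "u \<in> X"
  shows "alone Y c (l u) \<longleftrightarrow> alone X (c \<circ> l) u"
  using assms by (auto simp: alone_def bij_betw_def inj_on_eq_iff)

lemma complete_on_alone_neighbour:
  assumes "complete_on X R c" "alone X c a" "x \<in> X" "c x \<noteq> c a"
  obtains y where "y \<in> X" "c y = c x" "R a y"
  using assms complete_onE[OF assms(1), of a x] unfolding alone_def by metis

lemma complete_on_alone_related:
  assumes "complete_on X R c" "alone X c a" "alone X c b" "a \<noteq> b"
  shows "R a b"
  using assms complete_on_alone_neighbour[OF assms(1,2), of b] unfolding alone_def by metis

lemma inj_on_neighbours_of_alone:
  assumes "finite X" "complete_on X R c" "alone X c a"
    and card: "card {x \<in> X. x \<noteq> a \<and> R a x} < card (c ` X)"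
  shows "inj_on c {x \<in> X. x \<noteq> a \<and> R a x}"
proof (rule eq_card_imp_inj_on)
  let ?N = "{x \<in> X. x \<noteq> a \<and> R a x}"
  show "finite ?N" using assms(1) by simp
  then have "card (c ` ?N) \<le> card ?N" by (rule card_image_le)
  moreover have "c ` X \<subseteq> insert (c a) (c ` ?N)"
  proof
    fix i assume "i \<in> c ` X"
    then obtain x where x: "x \<in> X" "i = c x" by blast
    show "i \<in> insert (c a) (c ` ?N)"
    proof (cases "c x = c a")
      case False
      then obtain y where "y \<in> X" "c y = c x" "R a y"
        using complete_on_alone_neighbour[OF assms(2,3)] x(1) by blast
      then have "c y \<in> c ` ?N" using False by (intro imageI) auto
      then show ?thesis using \<open>c y = c x\<close> x(2) by simp
    qed (simp add: x)
  qed
  then have "card (c ` X) \<le> Suc (card (c ` ?N))"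
    using assms(1) card_mono[of "insert (c a) (c ` ?N)" "c ` X"] card_insert_le_m1[of _ "c ` ?N" "c a"]
    by (simp add: card_insert_if split: if_splits)
  ultimately show "card (c ` ?N) = card ?N" using card by simp
qed

lemma card_image_le_card_alone:
  assumes "finite X"
  shows "2 * card (c ` X) \<le> card X + card {a. alone X c a}"
proof -
  have fibres: "(\<Sum>i\<in>c ` X. card {x \<in> A. c x = i}) = card A" if "A \<subseteq> X" for A
    using sum.group[of A "c ` X" c "\<lambda>_. 1 :: nat"] that assms finite_subset by auto
  have "2 \<le> card {x \<in> X. c x = i} + card {x \<in> {a. alone X c a}. c x = i}" if i: "i \<in> c ` X" for i
  proof -
    obtain x where x: "x \<in> X" "c x = i" using i by blast
    have fin: "finite {x \<in> X. c x = i}" using assms by simp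
    show ?thesis
    proof (cases "alone X c x")
      case True
      have unique: "y = x" if "y \<in> X" "c y = i" for y
        using aloneD(2)[OF True that(1)] that(2) x(2) by simp
      have "{y \<in> X. c y = i} = {x}" "{y \<in> {a. alone X c a}. c y = i} = {x}"
        using unique x True by (blast dest: aloneD(1))+
      then show ?thesis by simp
    next
      case False
      then obtain y where "y \<in> X" "c y = i" "y \<noteq> x" using x by (metis aloneI)
      then have "card {x, y} \<le> card {x \<in> X. c x = i}" using fin x by (intro card_mono) auto
      then show ?thesis using \<open>y \<noteq> x\<close> by simp
    qed
  qed
  then have "(\<Sum>i\<in>c ` X. 2) \<le> (\<Sum>i\<in>c ` X. card {x \<in> X. c x = i} + card {x \<in> {a. alone X c a}. c x = i})"
    by (rule sum_mono)
  then show ?thesis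
    using fibres[of X] fibres[of "{a. alone X c a}"] by (auto simp: sum.distrib alone_def)
qed

section \<open>Colourings of the Klein quadric with at least 19 colours\<close>

lemma card_conjugate_star:
  fixes x :: "bit ^ 3"
  assumes "x \<noteq> 0"
  shows "card {u \<in> klein_quadric. u \<noteq> (x, 0) \<and> conjugate (x, 0) u} = 18"
proof -
  let ?S = "SIGMA m : {m. m \<cdot> x = 0}. {d. d \<cdot> m = 0}"
  have "card ?S = (\<Sum>m | m \<cdot> x = 0. if m = 0 then 8 else 4)"
    by (simp add: card_SigmaI card_orthogonal_vec3)
  also have "\<dots> = 8 + (\<Sum>m\<in>{m. m \<cdot> x = 0} - {0}. 4)"
    by (subst sum.remove[of _ 0]) simp_all
  also have "\<dots> = 20"
    using assms by (simp add: card_orthogonal_vec3)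
  finally have "card (prod.swap ` ?S) = 20"
    by (simp add: card_image)
  moreover have "{u \<in> klein_quadric. u \<noteq> (x, 0) \<and> conjugate (x, 0) u} = prod.swap ` ?S - {0, (x, 0)}"
    by (auto simp: dot_commute zero_prod_def image_iff)
  moreover have "{0, (x, 0)} \<subseteq> prod.swap ` ?S" "card {0, (x, 0 :: bit ^ 3)} = 2"
    using assms by (auto simp: zero_prod_def image_iff)
  ultimately show ?thesis by (simp add: card_Diff_subset)
qed

locale complete_klein_colouring =
  fixes c :: "plucker \<Rightarrow> 'c"
  assumes complete: "complete_on klein_quadric conjugate c"
    and card_colours: "19 \<le> card (c ` klein_quadric)"
begin

lemma eq_if_same_colour_near_alone:
  assumes alone: "alone klein_quadric c (x, 0)" and uv: "u \<in> klein_quadric" "v \<in> klein_quadric"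
    and "x \<cdot> snd u = 0" "x \<cdot> snd v = 0" "c u = c v"
  shows "u = v"
proof (cases "u = (x, 0) \<or> v = (x, 0)")
  case True
  then show ?thesis using alone uv \<open>c u = c v\<close> unfolding alone_def by metis
next
  case False
  have "x \<noteq> 0" using alone by (auto simp: alone_def)
  then have "card {u \<in> klein_quadric. u \<noteq> (x, 0) \<and> conjugate (x, 0) u} < card (c ` klein_quadric)"
    using card_conjugate_star card_colours by simp
  then have "inj_on c {u \<in> klein_quadric. u \<noteq> (x, 0) \<and> conjugate (x, 0) u}"
    by (rule inj_on_neighbours_of_alone[OF finite complete alone])
  then show ?thesis
    by (rule inj_onD) (use assms False in \<open>auto simp: conjugate_def\<close>)
qed

lemma conjugate_if_pencil_alone:
  assumes "alone klein_quadric c (x, 0)" "alone klein_quadric c (y, 0)" "alone klein_quadric c (x + y, 0)"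
    and u: "u \<in> klein_quadric" "x \<cdot> snd u = 0" "y \<cdot> snd u = 0"
    and v: "v \<in> klein_quadric" "x \<cdot> snd v = 0" "y \<cdot> snd v = 0"
  shows "conjugate u v"
proof -
  have alone: "alone klein_quadric c w" if w: "w \<in> klein_quadric" "x \<cdot> snd w = 0" "y \<cdot> snd w = 0" for w
  proof (rule aloneI[OF w(1)])
    fix z assume z: "z \<in> klein_quadric" "c z = c w"
    have xy: "(x + y) \<cdot> snd w = 0" using w by (simp add: dot_add_left)
    consider "x \<cdot> snd z = 0" | "y \<cdot> snd z = 0" | "(x + y) \<cdot> snd z = 0"
      by (cases "x \<cdot> snd z"; cases "y \<cdot> snd z") (auto simp: dot_add_left)
    then show "z = w"
      using eq_if_same_colour_near_alone[OF assms(1) z(1) w(1) _ w(2) z(2)]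
        eq_if_same_colour_near_alone[OF assms(2) z(1) w(1) _ w(3) z(2)]
        eq_if_same_colour_near_alone[OF assms(3) z(1) w(1) _ xy z(2)]
      by cases
  qed
  show ?thesis
  proof (cases "u = v")
    case False
    then show ?thesis
      using complete_on_alone_related[OF complete alone alone] u v by blast
  qed (simp add: conjugate_def)
qed

end

section \<open>Three non-coplanar lines through a point\<close>

lemma ex_other_indices: "\<exists>j k :: 3. distinct [i, j, k]"
  by (intro exI[of _ "i + 1"] exI[of _ "i + 2"]) simp

lemma ex_third_index: "\<exists>k :: 3. k \<noteq> i \<and> k \<noteq> j"
proof -
  obtain a b where "distinct [i, a, b]" using ex_other_indices by blast
  then show ?thesis by (cases "a = j") auto
qed

text \<open>
  The points and lines of the Fano plane of lines through \<open>p = (1, 0)\<close> are given by \<open>d\<close> and \<open>m\<close>. The lines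
  off \<open>p\<close> in the plane over a side or a median of the triangle are told apart by the points in which they
  meet its vertices and its centroid, the line through \<open>p\<close> of direction \<open>1\<close>: \<open>side i v\<close> contains
  \<open>(v $ j, axis j 1)\<close> for \<open>j \<noteq> i\<close>, and \<open>median i a n\<close> contains \<open>(a, axis i 1)\<close> and \<open>(n, 1)\<close>.
\<close>

definition side :: "3 \<Rightarrow> bit ^ 3 \<Rightarrow> plucker" where
  "side i v = (axis i 1 \<otimes> v, axis i 1)"

definition median :: "3 \<Rightarrow> bit \<Rightarrow> bit \<Rightarrow> plucker" where
  "median i a n = (a *s 1 + n *s axis i 1, 1 + axis i 1)"

definition midpoint :: "3 \<Rightarrow> plucker" where
  "midpoint i = (1 + axis i 1, 0)"

definition midlines :: "plucker set" where
  "midlines = {u \<in> klein_quadric. snd u = 1}"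

lemma snd_triangle_lines [simp]:
  "snd (vertex i) = 0" "snd (midpoint i) = 0" "snd (side i v) = axis i 1" "snd (median i a n) = 1 + axis i 1"
  by (simp_all add: vertex_def midpoint_def side_def median_def)

lemma triangle_lines_in_klein_quadric [simp]:
  "vertex i \<in> klein_quadric" "midpoint i \<in> klein_quadric"
  "side i v \<in> klein_quadric" "median i a n \<in> klein_quadric"
  using exhaust_3[of i]
  by (auto simp: vertex_def midpoint_def side_def median_def cross_def dot_def sum_3 vec_eq_iff forall_3
      axis_def algebra_simps)

lemma side_eq_iff: "side i v = side j u \<longleftrightarrow> i = j \<and> (\<forall>k. k \<noteq> i \<longrightarrow> v $ k = u $ k)"
  using exhaust_3[of i]
  by (auto simp: side_def cross_def vec_eq_iff forall_3 axis_def axis_eq_axis)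

lemma midpoint_eq_iff: "midpoint i = midpoint j \<longleftrightarrow> i = j"
  by (auto simp: midpoint_def axis_eq_axis)

lemma side_ne_midpoint: "side i v \<noteq> midpoint j"
  by (simp add: side_def midpoint_def axis_eq_0_iff)

lemma median_eq_iff: "median i a n = median i b m \<longleftrightarrow> a = b \<and> n = m"
  using exhaust_3[of i] by (auto simp: median_def vec_eq_iff forall_3 axis_def)

lemma ex_median:
  assumes "u \<in> klein_quadric" "snd u = 1 + axis i 1"
  shows "\<exists>a n. u = median i a n"
proof -
  obtain d where u: "u = (d, 1 + axis i 1)" using assms(2) by (cases u) auto
  have "d \<cdot> 1 = d $ i" using assms(1) by (simp add: u dot_add_right)
  moreover obtain j where "j \<noteq> i" using ex_third_index by blast
  ultimately have "u = median i (d $ j) (d $ i + d $ j)"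
    using exhaust_3[of i] exhaust_3[of j]
    by (auto simp: u median_def dot_def sum_3 vec_eq_iff forall_3 axis_def algebra_simps)
  then show ?thesis by blast
qed

lemma conjugate_side_side: "distinct [i, j, k] \<Longrightarrow> conjugate (side i v) (side j u) \<longleftrightarrow> v $ k = u $ k"
  using exhaust_3[of i] exhaust_3[of j] exhaust_3[of k]
  by (auto simp: side_def cross_def axis_def dot_def sum_3)

lemma conjugate_side_median: "i \<noteq> j \<Longrightarrow> conjugate (side i v) (median j a n) \<longleftrightarrow> v $ j = a"
  using exhaust_3[of i] exhaust_3[of j]
  by (auto simp: side_def median_def cross_def axis_def dot_def sum_3)

lemma conjugate_median_median: "i \<noteq> j \<Longrightarrow> conjugate (median i a n) (median j b m) \<longleftrightarrow> n = m"
  using exhaust_3[of i] exhaust_3[of j]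
  by (auto simp: median_def axis_def dot_def sum_3)

lemma not_conjugate_midpoint:
  assumes "i \<noteq> j"
  shows "\<not> conjugate (midpoint i) (side j v)" "\<not> conjugate (midpoint i) (median j a n)"
  using assms exhaust_3[of i] exhaust_3[of j]
  by (auto simp: midpoint_def side_def median_def axis_def dot_def sum_3)

lemma conjugate_midline_side:
  "u \<in> midlines \<Longrightarrow> conjugate u (side i v) \<longleftrightarrow> fst u $ i = 1 \<cdot> v + v $ i"
  using exhaust_3[of i] by (cases u) (auto simp: midlines_def side_def cross_def axis_def dot_def sum_3)

lemma conjugate_midline_median:
  "u \<in> midlines \<Longrightarrow> conjugate u (median i a n) \<longleftrightarrow> fst u $ i = a + n"
  by (cases u) (auto simp: midlines_def median_def dot_add_left dot_add_right dot_smult_left dot_one_one)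

lemma card_midlines: "card midlines = 4"
proof -
  have "bij_betw (\<lambda>d. (d, 1)) {d. d \<cdot> 1 = 0} midlines"
    by (rule bij_betwI[where g = fst]) (auto simp: midlines_def)
  then have "card midlines = card {d :: bit ^ 3. d \<cdot> 1 = 0}"
    by (simp add: bij_betw_same_card)
  then show ?thesis by (simp add: card_orthogonal_vec3)
qed

lemma card_range_side: "card (range (side i)) = 4"
proof -
  have "range (side i) = side i ` {v. v $ i = 0}"
  proof (intro equalityI subsetI)
    fix u assume "u \<in> range (side i)"
    then obtain v where "u = side i v" by blast
    then have "u = side i (\<chi> j. if j = i then 0 else v $ j)" by (simp add: side_eq_iff)
    then show "u \<in> side i ` {v. v $ i = 0}" by (rule image_eqI) simp
  qed auto
  moreover have "inj_on (side i) {v. v $ i = 0}"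
  proof (rule inj_onI, unfold vec_eq_iff, rule allI)
    fix u v :: "bit ^ 3" and k assume "u \<in> {v. v $ i = 0}" "v \<in> {v. v $ i = 0}" "side i u = side i v"
    then show "u $ k = v $ k" by (cases "k = i") (simp_all add: side_eq_iff)
  qed
  moreover have "card {v :: bit ^ 3. v $ i = 0} = 4"
    using card_orthogonal_vec3[of "axis i 1"] by (simp add: axis_eq_0_iff)
  ultimately show ?thesis by (simp add: card_image)
qed

locale three_alone_vertices = complete_klein_colouring +
  assumes alone: "alone klein_quadric c (vertex i)"
begin

lemma eq_if_same_colour:
  "u \<in> klein_quadric \<Longrightarrow> v \<in> klein_quadric \<Longrightarrow> snd u $ i = 0 \<Longrightarrow> snd v $ i = 0 \<Longrightarrow> c u = c v \<Longrightarrow> u = v"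
  using eq_if_same_colour_near_alone[of "axis i 1" u v] alone[of i] by (simp add: vertex_def)

lemma ex_same_colour:
  assumes "u \<in> klein_quadric"
  shows "\<exists>v\<in>klein_quadric. c v = c u \<and> snd v $ i = 0"
proof (cases "c u = c (vertex i)")
  case True
  then show ?thesis by (intro bexI[of _ "vertex i"]) simp_all
next
  case False
  then obtain v where "v \<in> klein_quadric" "c v = c u" "conjugate (vertex i) v"
    using complete_on_alone_neighbour[OF complete alone assms] by blast
  then show ?thesis by (intro bexI[of _ v]) (simp_all add: conjugate_def vertex_def)
qed

definition paired :: "3 \<Rightarrow> bit ^ 3 \<Rightarrow> bit \<Rightarrow> bool" where
  "paired i v n \<longleftrightarrow> c (side i v) = c (median i (v $ i) n)"

definition shared :: "3 \<Rightarrow> bit ^ 3 \<Rightarrow> bool" where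
  "shared i v \<longleftrightarrow> c (side i v) \<in> c ` midlines"

lemma shared_cong: "side i v = side j u \<Longrightarrow> shared i v \<longleftrightarrow> shared j u"
  by (simp add: shared_def)

lemma ex_paired: "\<exists>u n. paired i u n \<and> side i u = side i v"
proof -
  obtain w where w: "w \<in> klein_quadric" "c w = c (side i v)" "snd w $ i = 0"
    using ex_same_colour[of "side i v" i] by auto
  have "snd w $ j = 1" if "j \<noteq> i" for j
  proof (rule ccontr)
    assume "snd w $ j \<noteq> 1"
    then have "w = side i v" by (intro eq_if_same_colour[of _ _ j]) (use w that in \<open>simp_all add: axis_def\<close>)
    then show False using w(3) by simp
  qed
  then have "snd w = 1 + axis i 1"
    using w(3) by (auto simp: vec_eq_iff axis_def)
  then obtain a n where median: "w = median i a n"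
    using ex_median[OF w(1)] by blast
  define u where "u = (\<chi> j. if j = i then a else v $ j)"
  have side: "side i u = side i v" by (simp add: side_eq_iff u_def)
  have "paired i u n" using w(2) side by (simp add: paired_def u_def median)
  then show ?thesis using side by blast
qed

lemma paired_side_eq:
  assumes "paired i v n" "paired i u m" "side i v = side i u"
  shows "v = u"
proof -
  have "median i (v $ i) n = median i (u $ i) m"
    by (rule eq_if_same_colour[of _ _ i]) (use assms in \<open>simp_all add: paired_def\<close>)
  then have "v $ i = u $ i" by (simp add: median_eq_iff)
  then show "v = u" using assms(3) by (auto simp: side_eq_iff vec_eq_iff)
qed

lemma paired_median_eq:
  assumes "paired i v n" "paired i u n" "v $ i = u $ i"
  shows "v = u"
proof -
  obtain j where "j \<noteq> i" using ex_third_index by blast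
  have "side i v = side i u"
    by (rule eq_if_same_colour[of _ _ j])
      (use assms \<open>j \<noteq> i\<close> in \<open>simp_all add: paired_def axis_def\<close>)
  then show ?thesis using paired_side_eq assms(1,2) by blast
qed

lemma paired_class:
  assumes "paired i v n" "u \<in> klein_quadric" "c u = c (side i v)"
  shows "u = side i v \<or> u = median i (v $ i) n \<or> u \<in> midlines"
proof (cases "\<forall>j. snd u $ j = 1")
  case True
  then show ?thesis using assms(2) by (simp add: midlines_def vec_eq_iff)
next
  case False
  then obtain j where "snd u $ j = 0" by auto
  then show ?thesis
    using eq_if_same_colour[of u "side i v" j] eq_if_same_colour[of u "median i (v $ i) n" i] assms
    by (cases "j = i") (simp_all add: paired_def axis_def)
qed

lemma midpoint_class:
  assumes "u \<in> klein_quadric" "c u = c (midpoint i)"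
  shows "u = midpoint i \<or> u \<in> midlines"
proof (cases "\<forall>j. snd u $ j = 1")
  case True
  then show ?thesis using assms(1) by (simp add: midlines_def vec_eq_iff)
next
  case False
  then obtain j where "snd u $ j = 0" by auto
  then show ?thesis using eq_if_same_colour[of u "midpoint i" j] assms by simp
qed

lemma midpoint_colour_eq_iff: "c (midpoint i) = c (midpoint j) \<longleftrightarrow> i = j"
  using eq_if_same_colour[of "midpoint i" "midpoint j" 1] by (auto simp: midpoint_eq_iff)

lemma side_colour_ne_midpoint_colour: "c (side i v) \<noteq> c (midpoint j)"
proof -
  obtain k where "k \<noteq> i" using ex_third_index by blast
  then show ?thesis
    using eq_if_same_colour[of "side i v" "midpoint j" k] side_ne_midpoint by (auto simp: axis_def)
qed

lemma ex_midline_of_midpoint_colour: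
  assumes "paired i v n" "\<not> shared i v" "j \<noteq> i"
  shows "\<exists>q\<in>midlines. c q = c (midpoint j) \<and> (conjugate q (side i v) \<or> conjugate q (median i (v $ i) n))"
proof -
  obtain x y where x: "x \<in> klein_quadric" "c x = c (midpoint j)"
    and y: "y \<in> klein_quadric" "c y = c (side i v)" and xy: "conjugate x y"
    by (rule complete_onE[OF complete, of "midpoint j" "side i v"])
      (simp_all add: side_colour_ne_midpoint_colour[symmetric])
  have "y \<notin> midlines" using assms(2) y(2) by (metis imageI shared_def)
  then have "y = side i v \<or> y = median i (v $ i) n" using paired_class[OF assms(1) y] by blast
  moreover have "x \<in> midlines"
    using midpoint_class[OF x] calculation not_conjugate_midpoint[OF assms(3)] xy by blast
  ultimately show ?thesis using x(2) xy by blast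
qed

lemma card_le_4_if_midline_colours:
  assumes T: "T \<subseteq> klein_quadric" "\<And>u. u \<in> T \<Longrightarrow> snd u $ k = 0" and colours: "c ` T \<subseteq> c ` midlines"
  shows "card T \<le> 4"
proof -
  have "inj_on c T"
    by (rule inj_onI, rule eq_if_same_colour[of _ _ k]) (use T in auto)
  then have "card T = card (c ` T)" by (simp add: card_image)
  also have "\<dots> \<le> card (c ` midlines)" by (rule card_mono) (simp_all add: colours)
  also have "\<dots> \<le> 4" using card_image_le[of midlines c] by (simp add: card_midlines)
  finally show ?thesis .
qed

lemma midpoint_colour_on_midlines: "c (midpoint j) \<in> c ` midlines"
proof (rule ccontr)
  assume neg: "c (midpoint j) \<notin> c ` midlines"
  have shared: "shared i v" if "i \<noteq> j" for i v
  proof -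
    obtain u n where "paired i u n" and eq: "side i u = side i v" using ex_paired by blast
    then have "shared i u" using ex_midline_of_midpoint_colour that neg by (metis imageI)
    then show ?thesis using shared_cong[OF eq] by simp
  qed
  obtain i k where ijk: "distinct [j, i, k]" using ex_other_indices by blast
  let ?T = "insert (side k 0) (range (side i))"
  have "card ?T \<le> 4"
    by (rule card_le_4_if_midline_colours[of _ j])
      (use ijk shared in \<open>auto simp: shared_def axis_def\<close>)
  moreover have "side k 0 \<notin> range (side i)" using ijk by (auto simp: side_eq_iff)
  ultimately show False by (simp add: card_range_side)
qed

lemma shared_unique:
  assumes "shared i v" "shared j u"
  shows "side i v = side j u"
proof (rule ccontr)
  assume neq: "side i v \<noteq> side j u"
  obtain k where k: "k \<noteq> i" "k \<noteq> j" using ex_third_index by blast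
  have "card {side i v, side j u, midpoint 1, midpoint 2, midpoint 3} \<le> 4"
    by (rule card_le_4_if_midline_colours[of _ k])
      (use assms k midpoint_colour_on_midlines in \<open>auto simp: shared_def axis_def\<close>)
  then show False
    using neq by (simp add: side_ne_midpoint midpoint_eq_iff)
qed

lemma shared_if_even_pairs:
  assumes v: "paired i v n" "1 \<cdot> v = n" and u: "paired i u m" "1 \<cdot> u = m"
    and neq: "n + v $ i \<noteq> m + u $ i"
  shows "shared i v \<or> shared i u"
proof (rule ccontr)
  assume neg: "\<not> ?thesis"
  have attained: "(c (midpoint j), a) \<in> (\<lambda>q. (c q, fst q $ i)) ` midlines" if j: "j \<noteq> i" for j a
  proof -
    have "a = n + v $ i \<or> a = m + u $ i"
      using neq by (cases a; cases "n + v $ i"; cases "m + u $ i") simp_all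
    then obtain q where "q \<in> midlines" "c q = c (midpoint j)" "fst q $ i = a"
      using ex_midline_of_midpoint_colour[OF v(1) _ j] ex_midline_of_midpoint_colour[OF u(1) _ j] neg
      by (auto simp: conjugate_midline_side conjugate_midline_median v(2) u(2) add.commute)
    then show ?thesis by (intro image_eqI[of _ _ q]) simp_all
  qed
  obtain j k where ijk: "distinct [i, j, k]" using ex_other_indices by blast
  obtain r where r: "r \<in> midlines" "c r = c (midpoint i)"
    using midpoint_colour_on_midlines[of i] by (metis imageE)
  \<comment> \<open>Two colours on two midlines each and a third colour exceed the four midlines.\<close>
  let ?T = "{(c (midpoint i), fst r $ i), (c (midpoint j), 0), (c (midpoint j), 1),
    (c (midpoint k), 0), (c (midpoint k), 1)}"
  have "(c (midpoint i), fst r $ i) \<in> (\<lambda>q. (c q, fst q $ i)) ` midlines"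
    using r by (intro image_eqI[of _ _ r]) simp_all
  then have "?T \<subseteq> (\<lambda>q. (c q, fst q $ i)) ` midlines"
    using attained[of j] attained[of k] ijk by (simp add: eq_commute[of _ i])
  then have "card ?T \<le> card midlines"
    by (rule surj_card_le[rotated]) simp
  moreover have "card ?T = 5" using ijk by (auto simp: midpoint_colour_eq_iff)
  ultimately show False by (simp add: card_midlines)
qed

lemma ex_opposite_even_pair:
  assumes v: "paired i v n" "1 \<cdot> v = n"
  shows "\<exists>u m. paired i u m \<and> 1 \<cdot> u = m \<and> m + u $ i \<noteq> n + v $ i"
proof (rule ccontr)
  assume neg: "\<not> ?thesis"
  obtain j k where ijk: "distinct [i, j, k]" using ex_other_indices by blast
  have flip: "\<exists>u m. paired i u m \<and> m + u $ i = n + v $ i \<and> u $ j = v $ j + a \<and> u $ k = v $ k + a + 1" for a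
  proof -
    obtain u m where u: "paired i u m" "side i u = side i (v + a *s axis j 1 + (a + 1) *s axis k 1)"
      using ex_paired by blast
    then have jk: "u $ j = v $ j + a" "u $ k = v $ k + a + 1"
      using ijk by (auto simp: side_eq_iff axis_def)
    have "1 \<cdot> u + u $ i \<noteq> n + v $ i"
      using v(2) jk by (auto simp: dot_one[OF ijk] ac_simps)
    moreover from this have "1 \<cdot> u \<noteq> m" using neg u(1) by blast
    ultimately have "m + u $ i = n + v $ i"
      by (cases "m"; cases "1 \<cdot> u"; cases "u $ i"; cases "n + v $ i") simp_all
    then show ?thesis using u(1) jk by blast
  qed
  obtain u m where u: "paired i u m" "m + u $ i = n + v $ i" "u $ j = v $ j" "u $ k = v $ k + 1"
    using flip[of 0] by auto
  obtain w l where w: "paired i w l" "l + w $ i = n + v $ i" "w $ j = v $ j + 1" "w $ k = v $ k"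
    using flip[of 1] by auto
  \<comment> \<open>Three pairs compete for the two lines over the median \<open>i\<close> with the same sum of bits.\<close>
  consider "u $ i = v $ i" "m = n" | "w $ i = v $ i" "l = n" | "u $ i = w $ i" "m = l"
    using u(2) w(2) by (cases "u $ i"; cases "v $ i"; cases "w $ i"; cases m; cases n; cases l) simp_all
  then show False
    using paired_median_eq v(1) u w by cases fastforce+
qed

lemma odd_if_not_shared:
  assumes "\<And>v. \<not> shared i v" "paired i v n"
  shows "1 \<cdot> v \<noteq> n"
  using assms ex_opposite_even_pair[of i v n] shared_if_even_pairs[of i v n] by metis

lemma ex_odd_not_shared: "\<exists>v n. paired i v n \<and> 1 \<cdot> v \<noteq> n \<and> \<not> shared i v"
proof (rule ccontr)
  assume neg: "\<not> ?thesis"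
  obtain v where v: "\<And>u. shared i u \<Longrightarrow> side i u = side i v" using shared_unique by blast
  obtain j k where ijk: "distinct [i, j, k]" using ex_other_indices by blast
  have even: "\<exists>u m. paired i u m \<and> \<not> shared i u \<and> 1 \<cdot> u = m \<and> m + u $ i = v $ j + v $ k + a" for a
  proof -
    obtain u m where u: "paired i u m" "side i u = side i (v + axis j 1 + (a + 1) *s axis k 1)"
      using ex_paired by blast
    then have jk: "u $ j = v $ j + 1" "u $ k = v $ k + a + 1"
      using ijk by (auto simp: side_eq_iff axis_def)
    then have "side i u \<noteq> side i v" using ijk by (auto simp: side_eq_iff)
    then have "\<not> shared i u" using v by blast
    then have "1 \<cdot> u = m" using neg u(1) by blast
    moreover from this have "m + u $ i = v $ j + v $ k + a"
      using jk by (auto simp: dot_one[OF ijk] ac_simps)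
    ultimately show ?thesis using u(1) \<open>\<not> shared i u\<close> by blast
  qed
  obtain u m where u: "paired i u m" "\<not> shared i u" "1 \<cdot> u = m" "m + u $ i = v $ j + v $ k"
    using even[of 0] by auto
  obtain w l where w: "paired i w l" "\<not> shared i w" "1 \<cdot> w = l" "l + w $ i = v $ j + v $ k + 1"
    using even[of 1] by blast
  show False using shared_if_even_pairs[OF u(1,3) w(1,3)] u w by simp
qed

lemma complement_not_paired:
  assumes v: "paired i v n" "\<not> shared i v" and "i \<noteq> j" and "\<not> shared j (v + 1)"
  shows "\<not> paired j (v + 1) (n + 1)"
proof
  assume u: "paired j (v + 1) (n + 1)"
  obtain k where "k \<noteq> i" "k \<noteq> j" using ex_third_index by blast
  then have ijk: "distinct [i, j, k]" using \<open>i \<noteq> j\<close> by auto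
  have "c (side i v) \<noteq> c (side j (v + 1))"
  proof
    assume "c (side i v) = c (side j (v + 1))"
    then have "side i v = side j (v + 1)"
      by (intro eq_if_same_colour[of _ _ k]) (use \<open>k \<noteq> i\<close> \<open>k \<noteq> j\<close> in \<open>simp_all add: axis_def\<close>)
    then show False using \<open>i \<noteq> j\<close> by (simp add: side_eq_iff)
  qed
  then obtain x y where x: "x \<in> klein_quadric" "c x = c (side i v)"
    and y: "y \<in> klein_quadric" "c y = c (side j (v + 1))" and xy: "conjugate x y"
    by (rule complete_onE[OF complete, rotated 2]) simp_all
  have "x = side i v \<or> x = median i (v $ i) n"
    using paired_class[OF v(1) x] v(2) x(2) by (metis imageI shared_def)
  moreover have "y = side j (v + 1) \<or> y = median j (v $ j + 1) (n + 1)"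
    using paired_class[OF u y] assms(4) y(2) by (metis imageI one_index shared_def vector_add_component)
  ultimately show False
    using xy ijk conjugate_side_side[OF ijk] conjugate_side_median[of i j] conjugate_side_median[of j i]
      conjugate_median_median[of i j] by (auto simp: conjugate_commute[of "median i (v $ i) n"])
qed

lemma paired_complement:
  assumes no_shared: "\<And>v. \<not> shared i v" and v: "paired i v n"
  shows "paired i (v + 1) (n + 1)"
proof -
  obtain j k where ijk: "distinct [i, j, k]" using ex_other_indices by blast
  obtain u m where u: "paired i u m" "side i u = side i (v + 1)" using ex_paired by blast
  then have jk: "u $ j = v $ j + 1" "u $ k = v $ k + 1" using ijk by (auto simp: side_eq_iff)
  have "1 \<cdot> u + u $ i = 1 \<cdot> v + v $ i"
    using jk by (simp add: dot_one[OF ijk] ac_simps)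
  moreover have "1 \<cdot> u \<noteq> m" "1 \<cdot> v \<noteq> n"
    using odd_if_not_shared[OF no_shared] u(1) v by blast+
  moreover have "\<not> (u $ i = v $ i \<and> m = n)" using paired_median_eq[of i u m v] u(1) v jk by auto
  ultimately have "u $ i = v $ i + 1" "m = n + 1"
    by (cases "u $ i"; cases "v $ i"; cases m; cases n; simp)+
  moreover from this(1) have "u = v + 1"
    using u(2) by (auto simp: side_eq_iff vec_eq_iff)
  ultimately show ?thesis using u(1) by simp
qed

lemma card_paired: "4 \<le> card {(v, n). paired i v n}"
proof -
  have "range (side i) \<subseteq> (\<lambda>(v, n). side i v) ` {(v, n). paired i v n}"
  proof
    fix u assume "u \<in> range (side i)"
    then obtain v where "u = side i v" by blast
    then obtain w n where "paired i w n" "u = side i w" using ex_paired[of i v] by auto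
    then show "u \<in> (\<lambda>(v, n). side i v) ` {(v, n). paired i v n}" by force
  qed
  then show ?thesis using surj_card_le[of "{(v, n). paired i v n}" "range (side i)"]
    by (simp add: card_range_side)
qed

lemma paired_if_odd:
  assumes no_shared: "\<And>v. \<not> shared i v" "\<And>v. \<not> shared j v" and "i \<noteq> j" "1 \<cdot> v \<noteq> n"
  shows "paired i v n \<or> paired j v n"
proof -
  let ?P = "\<lambda>i. {(v, n). paired i v n}" and ?O = "{(v :: bit ^ 3, n). 1 \<cdot> v \<noteq> n}"
  have "?P i \<inter> ?P j = {}"
    using paired_complement[of j] complement_not_paired[of i _ _ j] assms(1-3) by auto
  then have "card (?P i \<union> ?P j) = card (?P i) + card (?P j)"
    by (intro card_Un_disjoint) simp_all
  then have "8 \<le> card (?P i \<union> ?P j)"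
    using card_paired[of i] card_paired[of j] by linarith
  moreover have "card ?O = 8"
  proof -
    have "bij_betw fst ?O UNIV"
      by (rule bij_betwI[where g = "\<lambda>v. (v, 1 \<cdot> v + 1)"]) (auto simp: bit_neq_iff)
    then show ?thesis by (simp add: bij_betw_same_card)
  qed
  moreover have "?P i \<union> ?P j \<subseteq> ?O"
    using odd_if_not_shared[of i] odd_if_not_shared[of j] no_shared by blast
  ultimately have "?P i \<union> ?P j = ?O" by (intro card_seteq) simp_all
  then show ?thesis using assms(4) by auto
qed

end

lemma not_three_alone_vertices: "\<not> three_alone_vertices c"
proof
  assume "three_alone_vertices c"
  then interpret three_alone_vertices c .
  obtain k where not_shared: "\<And>i v. i \<noteq> k \<Longrightarrow> \<not> shared i v"
    using shared_unique side_eq_iff by metis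
  obtain i j where "distinct [k, i, j]" using ex_other_indices by blast
  then have ne: "i \<noteq> k" "j \<noteq> k" "i \<noteq> j" by auto
  obtain v n where v: "paired k v n" "1 \<cdot> v \<noteq> n" "\<not> shared k v" using ex_odd_not_shared by blast
  have "1 \<cdot> (v + 1) \<noteq> n + 1" using v(2) by (simp add: dot_add_right dot_one_one)
  then have "paired i (v + 1) (n + 1) \<or> paired j (v + 1) (n + 1)"
    using paired_if_odd[of i j] not_shared ne by blast
  then show False
    using complement_not_paired[OF v(1,3)] not_shared ne by metis
qed

lemma (in complete_klein_colouring) not_alone_vertices:
  assumes "alone klein_quadric c (vertex 1)" "alone klein_quadric c (vertex 2)"
    and "alone klein_quadric c (vertex 3) \<or> alone klein_quadric c (vertex 1 + vertex 2)"
  shows False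
  using assms(3)
proof
  assume "alone klein_quadric c (vertex 3)"
  then have "three_alone_vertices c"
    by unfold_locales (use assms(1,2) exhaust_3 in metis)
  then show False using not_three_alone_vertices by blast
next
  assume "alone klein_quadric c (vertex 1 + vertex 2)"
  then have "conjugate (vertex 3) (prod.swap (vertex 3))"
    using assms(1,2) by (intro conjugate_if_pencil_alone[of "axis 1 1" "axis 2 1"])
      (simp_all add: vertex_def axis_eq_0_iff, simp_all add: axis_def)
  then show False by (simp add: vertex_def)
qed

lemma card_colours_le_18:
  fixes c :: "(bit ^ 4) set \<Rightarrow> 'c"
  assumes complete: "complete_on pg_lines concurrent c"
  shows "card (c ` pg_lines) \<le> 18"
proof (rule ccontr)
  assume "\<not> card (c ` pg_lines) \<le> 18"
  then have card: "19 \<le> card (c ` pg_lines)" by simp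
  have "finite (pg_lines :: (bit ^ 4) set set)" using card_pg_lines_PG32 card.infinite by fastforce
  then have "3 \<le> card {L. alone pg_lines c L}"
    using card_image_le_card_alone[of pg_lines c] card card_pg_lines_PG32 by simp
  then obtain T where "T \<subseteq> {L. alone pg_lines c L}" "card T = 3"
    by (metis obtain_subset_with_card_n)
  then obtain A B C where alone: "alone pg_lines c A" "alone pg_lines c B" "alone pg_lines c C"
    and neq: "A \<noteq> B" "A \<noteq> C" "B \<noteq> C"
    by (auto simp: card_3_iff)
  note concurrent = complete_on_alone_related[OF complete]
  obtain l where l: "klein_labelling l" "l (vertex 1) = A" "l (vertex 2) = B"
    "l (vertex 3) = C \<or> l (vertex 1 + vertex 2) = C"
    using ex_labelling_of_concurrent_lines[OF alone[THEN aloneD(1)] neq concurrent concurrent concurrent]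
      alone neq by blast
  note bij = klein_labellingD(1)[OF l(1)]
  interpret complete_klein_colouring "c \<circ> l"
  proof
    show "complete_on klein_quadric conjugate (c \<circ> l)"
      using complete complete_on_bij_betw[of l _ _ concurrent conjugate, OF klein_labellingD[OF l(1)]]
      by blast
    show "19 \<le> card ((c \<circ> l) ` klein_quadric)"
      using card bij by (metis bij_betw_imp_surj_on image_comp)
  qed
  have "vertex 1 + vertex 2 \<in> klein_quadric"
    by (simp add: vertex_def axis_eq_axis)
  then show False
    using not_alone_vertices alone l alone_bij_betw[OF bij] triangle_lines_in_klein_quadric(1) by metis
qed

section \<open>A complete colouring with 18 colours\<close>

lemma ex_colouring_of_disjoint_classes:
  assumes "As \<noteq> []" and disjnt: "\<And>i j. i < length As \<Longrightarrow> j < length As \<Longrightarrow> i \<noteq> j \<Longrightarrow> disjnt (As ! i) (As ! j)"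
  shows "\<exists>c. (\<forall>x. c x \<in> {1..length As}) \<and> (\<forall>i<length As. \<forall>x\<in>As ! i. c x = Suc i)"
proof -
  define c where
    "c x = (if \<exists>i<length As. x \<in> As ! i then Suc (SOME i. i < length As \<and> x \<in> As ! i) else 1)" for x
  have c_eq: "c x = Suc i" if "i < length As" "x \<in> As ! i" for i x
  proof -
    have "(SOME i. i < length As \<and> x \<in> As ! i) = i"
      by (rule some_equality) (use that disjnt in \<open>auto simp: disjnt_iff\<close>)
    then show ?thesis using that by (auto simp: c_def)
  qed
  moreover have "c x \<in> {1..length As}" for x
  proof (cases "\<exists>i<length As. x \<in> As ! i")
    case True
    then show ?thesis using c_eq by auto
  next
    case False
    then have "c x = 1" unfolding c_def by (rule if_not_P)
    then show ?thesis using \<open>As \<noteq> []\<close> by (simp add: Suc_le_eq)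
  qed
  ultimately show ?thesis by blast
qed

lemma ex_complete_on_of_classes:
  assumes classes: "\<forall>A\<in>set As. A \<noteq> {} \<and> A \<subseteq> X" and "As \<noteq> []" and sym: "\<And>x y. R x y \<Longrightarrow> R y x"
    and sorted: "sorted_wrt (\<lambda>A B. disjnt A B \<and> (\<exists>x\<in>A. \<exists>y\<in>B. R x y)) As"
  shows "\<exists>c. c ` X = {1..length As} \<and> complete_on X R c"
proof -
  have related: "disjnt (As ! i) (As ! j) \<and> (\<exists>x\<in>As ! i. \<exists>y\<in>As ! j. R x y)"
    if "i < length As" "j < length As" "i \<noteq> j" for i j
  proof (cases "i < j")
    case True
    then show ?thesis using sorted_wrt_nth_less[OF sorted] that by blast
  next
    case False
    then show ?thesis using sorted_wrt_nth_less[OF sorted, of j i] that sym disjnt_sym by fastforce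
  qed
  then obtain c where range: "\<And>x. c x \<in> {1..length As}"
    and c_eq: "\<And>i x. i < length As \<Longrightarrow> x \<in> As ! i \<Longrightarrow> c x = Suc i"
    using ex_colouring_of_disjoint_classes[OF \<open>As \<noteq> []\<close>] by blast
  have "k \<in> c ` X" if k: "k \<in> {1..length As}" for k
  proof -
    obtain i where i: "k = Suc i" "i < length As" using k by (cases k) auto
    then obtain x where "x \<in> As ! i" "x \<in> X" using classes nth_mem by blast
    then show ?thesis using c_eq[OF i(2)] i(1) by (metis image_eqI)
  qed
  moreover have "complete_on X R c"
    unfolding complete_on_def
  proof (intro ballI impI)
    fix x y assume "c x \<noteq> c y"
    obtain i j where ij: "c x = Suc i" "i < length As" "c y = Suc j" "j < length As"
      using range[of x] range[of y] by (cases "c x"; cases "c y") auto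
    then obtain x' y' where "x' \<in> As ! i" "y' \<in> As ! j" "R x' y'"
      using related[of i j] \<open>c x \<noteq> c y\<close> by auto
    then show "\<exists>x'\<in>X. \<exists>y'\<in>X. c x' = c x \<and> c y' = c y \<and> R x' y'"
      using ij c_eq classes by (metis nth_mem subsetD)
  qed
  ultimately show ?thesis using range by blast
qed

text \<open>Found by computer, searching for colourings invariant under cyclic shifts of the coordinates.\<close>

definition colour_classes :: "plucker set list" where
  "colour_classes =
     concat (map (\<lambda>(i, j, k).
       [{(0, axis i 1)},
        {(0, 1 + axis i 1), (1, 1 + axis i 1)},
        {(axis i 1, 0), (1 + axis i 1, 1)},
        {(axis i 1, axis j 1), (1 + axis i 1, axis i 1)},
        {(axis i 1, axis k 1), (axis j 1, 1 + axis j 1)}]) [(1, 2, 3), (2, 3, 1), (3, 1, 2)]) @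
     [{(0, 1), (1, 0)},
      (\<lambda>i. (1 + axis i 1, 0)) ` {1, 2, 3},
      (\<lambda>i. (1 + axis i 1, 1 + axis i 1)) ` {1, 2, 3}]"

lemma colour_classes_in_klein_quadric:
  "\<forall>A\<in>set colour_classes. A \<noteq> {} \<and> A \<subseteq> klein_quadric"
  by (simp add: colour_classes_def dot_def sum_3 axis_def vec_eq_iff forall_3)

lemma colour_classes_disjnt_conjugate:
  "sorted_wrt (\<lambda>A B. disjnt A B \<and> (\<exists>u\<in>A. \<exists>v\<in>B. conjugate u v)) colour_classes"
  by (simp add: colour_classes_def dot_def sum_3 axis_def vec_eq_iff forall_3)

section \<open>The pseudoachromatic index\<close>

lemma complete_coloring_pg_iff:
  "complete_coloring (pg_points :: (bit ^ 'n) set set) pg_lines (\<subseteq>) k c \<longleftrightarrow>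
     c ` pg_lines = {1..k} \<and> complete_on pg_lines concurrent c"
proof (cases "c ` pg_lines = {1..k}")
  case True
  have "(\<exists>p\<in>pg_points. \<exists>L\<in>pg_lines. \<exists>M\<in>pg_lines. p \<subseteq> L \<and> p \<subseteq> M \<and> c L = i \<and> c M = j) \<longleftrightarrow>
    (\<exists>L\<in>pg_lines. \<exists>M\<in>pg_lines. c L = i \<and> c M = j \<and> (\<exists>p\<in>pg_points. p \<subseteq> L \<and> p \<subseteq> M))" for i j
    by blast
  also have "\<dots> i j \<longleftrightarrow>
    (\<exists>L\<in>pg_lines. \<exists>M\<in>pg_lines. c L = i \<and> c M = j \<and> concurrent L M)" for i j
    by (intro bex_cong conj_cong refl) (simp add: concurrent_iff_common_pg_point)
  finally show ?thesis
    unfolding complete_coloring_def line_coloring_def complete_on_def True[symmetric] by simp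
qed (simp add: complete_coloring_def line_coloring_def)

lemma ex_complete_coloring_18:
  "\<exists>c. complete_coloring (pg_points :: (bit ^ 4) set set) pg_lines (\<subseteq>) 18 c"
proof -
  have "length colour_classes = 18" by (simp add: colour_classes_def)
  moreover have "colour_classes \<noteq> []" by (simp add: colour_classes_def)
  ultimately obtain c :: "plucker \<Rightarrow> nat"
    where c: "c ` klein_quadric = {1..18}" "complete_on klein_quadric conjugate c"
    using ex_complete_on_of_classes[OF colour_classes_in_klein_quadric _ _ colour_classes_disjnt_conjugate]
      conjugate_commute by (metis (no_types, lifting))
  obtain l where l: "klein_labelling l" using ex_klein_labelling by blast
  let ?g = "inv_into klein_quadric l"
  have g: "bij_betw ?g pg_lines klein_quadric" by (rule bij_betw_inv_into[OF klein_labellingD(1)[OF l]])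
  have "conjugate (?g L) (?g M) \<longleftrightarrow> concurrent L M" if "L \<in> pg_lines" "M \<in> pg_lines" for L M
    using klein_labellingD(2)[OF l, of "?g L" "?g M"] bij_betwE[OF g]
      bij_betw_inv_into_right[OF klein_labellingD(1)[OF l]] that by simp
  then have "complete_on pg_lines concurrent (c \<circ> ?g)"
    using c(2) complete_on_bij_betw[of ?g _ _ conjugate concurrent, OF g] by blast
  moreover have "(c \<circ> ?g) ` pg_lines = {1..18}"
    using c(1) g by (metis bij_betw_imp_surj_on image_comp)
  ultimately show ?thesis unfolding complete_coloring_pg_iff by blast
qed

lemma complete_coloring_le_18:
  assumes "complete_coloring (pg_points :: (bit ^ 4) set set) pg_lines (\<subseteq>) k c"
  shows "k \<le> 18"
  using assms card_colours_le_18[of c] by (auto simp: complete_coloring_pg_iff)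

theorem theorem6:
  "pseudoachromatic_index (pg_points :: (bit ^ 4) set set) (pg_lines :: (bit ^ 4) set set) (\<subseteq>) = 18"
  unfolding pseudoachromatic_index_def
proof (rule Max_eqI)
  show "finite {k. \<exists>c. complete_coloring (pg_points :: (bit ^ 4) set set) pg_lines (\<subseteq>) k c}"
    by (rule finite_subset[of _ "{..18}"]) (use complete_coloring_le_18 in auto)
qed (use complete_coloring_le_18 ex_complete_coloring_18 in auto)

end
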